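(* Let $\Gamma$ be the Cayley graph of the lamplighter group $\mathbb{Z}_2\wr\mathbb{Z}$ with respect to the switch-walk-switch generating set. Then $\Gamma$ satisfies strong $\{f(n)\}$-retainment for $f(n)=2^{(n+2)/2}$.
   Context: $\mathbb{Z}_2\wr\mathbb{Z}$ is the group of pairs $(k,L)$ with $k\in\mathbb{Z}$ and $L:\mathbb{Z}\to\mathbb{Z}_2$ finitely supported, with product $(k_1,L_1)(k_2,L_2)=(k_1+k_2,L)$, where $L(s)=L_1(s)+L_2(s-k_1)$. Write $\delta_j$ for the indicator function of $j\in\mathbb{Z}$. The switch-walk-switch generating set consists of all products (switch or not)(step $\pm1$)(switch or not), i.e. of the elements $(0,a\delta_0)(\varepsilon,0)(0,b\delta_0)=(\varepsilon,a\delta_0+b\delta_{\varepsilon})$ with $a,b\in\mathbb{Z}_2$ and $\varepsilon\in\{1,-1\}$. The Cayley graph has edges $x\sim xs$ for $s$ a generator. $B_n$ is the ball of radius $n$ around the identity for the graph distance and $v_\Gamma(n)=|B_n|$. Fire process: a fire breaks out at time $0$ on a finite set $F_0\subset\Gamma$. At each time $n\ge 1$ a set $W_n$ with $|W_n|\le f(n)$ of vertices not on fire ($W_n\cap F_{n-1}=\emptyset$) is declared protected forever, and then $F_n=F_{n-1}\cup\{x : x\sim y \text{ for some } y\in F_{n-1},\ x\notin W_1\cup\dots\cup W_n\}$. Such a sequence $\{W_n\}_{n\ge1}$ is an $\{f(n)\}$-allowed strategy. Let $U=\Gamma\setminus\bigcup_n F_n$ be the set of vertices never on fire. $\Gamma$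 has the strong $\{f(n)\}$-retaining property (satisfies strong $\{f(n)\}$-retainment) if for every finite $F_0$ there exist a constant $c=c(F_0)>0$ and an $\{f(n)\}$-allowed strategy such that $|U\cap B_n|\ge c\,v_\Gamma(n)$ for all $n$ large enough. *)

theory Defs
  imports
    Complex_Main
    "HOL-Library.Z2"
    "HOL-Algebra.Group"
    "Graph_Theory.Pair_Digraph"
begin

section \<open>Cayley graphs and balls\<close>

text \<open>
  An undirected graph is represented by a symmetric digraph.  The digraph below is symmetric
  as soon as \<open>S\<close> is closed under inverses; see \<open>cayley_graph_sym\<close>.
\<close>

definition cayley_graph :: "('a, 'b) monoid_scheme \<Rightarrow> 'a set \<Rightarrow> 'a pair_pre_digraph" where
  "cayley_graph \<Gamma> S =
     \<lparr> pverts = carrier \<Gamma>, parcs = {(x, x \<otimes>\<^bsub>\<Gamma>\<^esub> s) | x s. x \<in> carrier \<Gamma> \<and> s \<in> S} \<rparr>"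

lemma cayley_graph_simps [simp]:
  "pverts (cayley_graph \<Gamma> S) = carrier \<Gamma>"
  "parcs (cayley_graph \<Gamma> S) = {(x, x \<otimes>\<^bsub>\<Gamma>\<^esub> s) | x s. x \<in> carrier \<Gamma> \<and> s \<in> S}"
  by (simp_all add: cayley_graph_def)

lemma (in group) cayley_graph_sym:
  assumes S: "S \<subseteq> carrier G" and inv: "\<And>s. s \<in> S \<Longrightarrow> inv s \<in> S"
  shows "pair_sym_digraph (cayley_graph G S)"
proof
  show "symmetric (with_proj (cayley_graph G S))"
    unfolding symmetric_def
  proof (rule symI)
    fix x y
    assume "(x, y) \<in> arcs_ends (with_proj (cayley_graph G S))"
    then obtain s where s: "x \<in> carrier G" "s \<in> S" "y = x \<otimes> s" by auto
    have "x = y \<otimes> inv s" using s S by (auto simp: m_assoc)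
    moreover have "y \<in> carrier G" using s S by auto
    ultimately show "(y, x) \<in> arcs_ends (with_proj (cayley_graph G S))"
      using inv[OF s(2)] by auto
  qed
qed (use S in auto)

definition gball :: "'a pair_pre_digraph \<Rightarrow> 'a \<Rightarrow> nat \<Rightarrow> 'a set" where
  "gball G r n =
     {x \<in> pverts G. \<exists>p. pre_digraph.awalk (with_proj G) r p x \<and> length p \<le> n}"

lemma finite_gball:
  assumes "pair_wf_digraph G" and loc: "\<And>x. finite {y. (x, y) \<in> parcs G}"
  shows "finite (gball G r n)"
proof -
  interpret pair_wf_digraph G by fact
  show ?thesis
  proof (induction n arbitrary: r)
    case 0
    have "gball G r 0 \<subseteq> {r}"
      by (auto simp: gball_def awalk_Nil_iff)
    then show ?case using finite_subset by blast
  next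
    case (Suc n)
    have "gball G r (Suc n) \<subseteq> {r} \<union> (\<Union>y\<in>{y. (r, y) \<in> parcs G}. gball G y n)"
    proof
      fix x assume "x \<in> gball G r (Suc n)"
      then obtain p where p: "x \<in> pverts G" "awalk r p x" "length p \<le> Suc n"
        by (auto simp: gball_def)
      show "x \<in> {r} \<union> (\<Union>y\<in>{y. (r, y) \<in> parcs G}. gball G y n)"
      proof (cases p)
        case Nil
        then show ?thesis using p by (auto simp: awalk_Nil_iff)
      next
        case (Cons e q)
        then have "e \<in> parcs G" "fst e = r" "awalk (snd e) q x"
          using p by (auto simp: awalk_Cons_iff)
        then show ?thesis
          using p Cons by (cases e) (auto simp: gball_def)
      qed
    qed
    then show ?case
      by (rule finite_subset) (use Suc.IH loc in auto)
  qed
qed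

section \<open>The fire process\<close>

text \<open>The entry \<open>W 0\<close> of a strategy is never used: protection starts at time 1.\<close>

fun fire :: "'a pair_pre_digraph \<Rightarrow> 'a set \<Rightarrow> (nat \<Rightarrow> 'a set) \<Rightarrow> nat \<Rightarrow> 'a set" where
  "fire G F\<^sub>0 W 0 = F\<^sub>0"
| "fire G F\<^sub>0 W (Suc n) =
     fire G F\<^sub>0 W n \<union>
     {x \<in> pverts G. (\<exists>y \<in> fire G F\<^sub>0 W n. (y, x) \<in> parcs G) \<and> x \<notin> (\<Union>i\<in>{1..Suc n}. W i)}"

definition allowed_strategy ::
    "'a pair_pre_digraph \<Rightarrow> (nat \<Rightarrow> real) \<Rightarrow> 'a set \<Rightarrow> (nat \<Rightarrow> 'a set) \<Rightarrow> bool" where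
  "allowed_strategy G f F\<^sub>0 W \<longleftrightarrow>
     (\<forall>n\<ge>1. W n \<subseteq> pverts G \<and> finite (W n) \<and> real (card (W n)) \<le> f n \<and>
            W n \<inter> fire G F\<^sub>0 W (n - 1) = {})"

definition never_on_fire ::
    "'a pair_pre_digraph \<Rightarrow> 'a set \<Rightarrow> (nat \<Rightarrow> 'a set) \<Rightarrow> 'a set" where
  "never_on_fire G F\<^sub>0 W = pverts G - (\<Union>n. fire G F\<^sub>0 W n)"

text \<open>
  Here \<open>r\<close> is the centre of the balls; for a Cayley graph it is the identity.  Cardinalities
  of balls are meaningful in locally finite graphs, cf. \<open>finite_gball\<close>.
\<close>

definition strong_retaining ::
    "'a pair_pre_digraph \<Rightarrow> 'a \<Rightarrow> (nat \<Rightarrow> real) \<Rightarrow> bool" where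
  "strong_retaining G r f \<longleftrightarrow>
     (\<forall>F\<^sub>0. finite F\<^sub>0 \<and> F\<^sub>0 \<subseteq> pverts G \<longrightarrow>
        (\<exists>c::real. c > 0 \<and>
          (\<exists>W. allowed_strategy G f F\<^sub>0 W \<and>
             (\<forall>\<^sub>F n in sequentially.
                real (card (never_on_fire G F\<^sub>0 W \<inter> gball G r n))
                  \<ge> c * real (card (gball G r n))))))"

section \<open>The lamplighter group\<close>

definition lamplighter :: "(int \<times> (int \<Rightarrow> bit)) monoid" where
  "lamplighter =
     \<lparr> carrier = {(k, L). finite {s. L s \<noteq> 0}},
       monoid.mult = (\<lambda>(k\<^sub>1, L\<^sub>1) (k\<^sub>2, L\<^sub>2). (k\<^sub>1 + k\<^sub>2, \<lambda>s. L\<^sub>1 s + L\<^sub>2 (s - k\<^sub>1))),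
       one = (0, \<lambda>_. 0) \<rparr>"

text \<open>\<open>lamp a j\<close> is \<open>a\<close> times the indicator function of \<open>j\<close>.\<close>

definition lamp :: "bit \<Rightarrow> int \<Rightarrow> int \<Rightarrow> bit" where
  "lamp a j = (\<lambda>s. if s = j then a else 0)"

definition sws_generators :: "(int \<times> (int \<Rightarrow> bit)) set" where
  "sws_generators =
     {(0, lamp a 0) \<otimes>\<^bsub>lamplighter\<^esub> (\<epsilon>, \<lambda>_. 0) \<otimes>\<^bsub>lamplighter\<^esub> (0, lamp b 0) | a b \<epsilon>.
        \<epsilon> \<in> {1, -1}}"

lemma sws_generators_eq:
  "sws_generators = {(\<epsilon>, \<lambda>s. lamp a 0 s + lamp b \<epsilon> s) | a b \<epsilon>. \<epsilon> \<in> {1, -1}}"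
proof -
  have "(\<lambda>s. lamp b 0 (s - \<epsilon>)) = lamp b \<epsilon>" for b \<epsilon>
    by (auto simp: lamp_def)
  then show ?thesis
    by (auto simp: sws_generators_def lamplighter_def fun_eq_iff)
qed

lemma group_lamplighter: "group lamplighter"
proof (rule groupI)
  fix x y assume "x \<in> carrier lamplighter" "y \<in> carrier lamplighter"
  then obtain k L k' L' where xy: "x = (k, L)" "y = (k', L')"
    "finite {s. L s \<noteq> 0}" "finite {s. L' s \<noteq> 0}"
    by (auto simp: lamplighter_def)
  have "{s. L s + L' (s - k) \<noteq> 0} \<subseteq> {s. L s \<noteq> 0} \<union> (\<lambda>s. s + k) ` {s. L' s \<noteq> 0}"
  proof
    fix s assume "s \<in> {s. L s + L' (s - k) \<noteq> 0}"
    then have "L s \<noteq> 0 \<or> L' (s - k) \<noteq> 0" by (metis (mono_tags) add_0 mem_Collect_eq)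
    then show "s \<in> {s. L s \<noteq> 0} \<union> (\<lambda>s. s + k) ` {s. L' s \<noteq> 0}"
      by (auto intro: image_eqI[of _ _ "s - k"])
  qed
  then have "finite {s. L s + L' (s - k) \<noteq> 0}"
    by (rule finite_subset) (use xy in auto)
  then show "x \<otimes>\<^bsub>lamplighter\<^esub> y \<in> carrier lamplighter"
    by (simp add: xy lamplighter_def)
next
  fix x assume "x \<in> carrier lamplighter"
  then obtain k L where x: "x = (k, L)" "finite {s. L s \<noteq> 0}"
    by (auto simp: lamplighter_def)
  have "{s. L (s + k) \<noteq> 0} \<subseteq> (\<lambda>s. s - k) ` {s. L s \<noteq> 0}"
    by (force simp: image_iff)
  then have "finite {s. L (s + k) \<noteq> 0}"
    by (rule finite_subset) (use x in auto)
  then show "\<exists>y\<in>carrier lamplighter. y \<otimes>\<^bsub>lamplighter\<^esub> x = \<one>\<^bsub>lamplighter\<^esub>"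
    by (intro bexI[of _ "(-k, \<lambda>s. L (s + k))"]) (auto simp: x lamplighter_def)
qed (auto simp: lamplighter_def add.assoc diff_diff_eq fun_eq_iff
       simp flip: bit_not_zero_iff simp del: bit_not_one_iff)

definition lamplighter_graph :: "(int \<times> (int \<Rightarrow> bit)) pair_pre_digraph" where
  "lamplighter_graph = cayley_graph lamplighter sws_generators"

lemma sws_generators_carrier: "sws_generators \<subseteq> carrier lamplighter"
proof -
  have "finite {s. lamp a 0 s + lamp b \<epsilon> s \<noteq> 0}" for a b \<epsilon>
    by (rule finite_subset[of _ "{0, \<epsilon>}"]) (auto simp: lamp_def)
  then show ?thesis by (auto simp: sws_generators_eq lamplighter_def)
qed

lemma sws_generators_inv:
  assumes "s \<in> sws_generators"
  shows "inv\<^bsub>lamplighter\<^esub> s \<in> sws_generators"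
proof -
  interpret group lamplighter by (rule group_lamplighter)
  obtain a b \<epsilon> where s: "s = (\<epsilon>, \<lambda>t. lamp a 0 t + lamp b \<epsilon> t)" "\<epsilon> \<in> {1, -1}"
    using assms by (auto simp: sws_generators_eq)
  define t where "t = (-\<epsilon>, \<lambda>t. lamp b 0 t + lamp a (-\<epsilon>) t)"
  have t: "t \<in> sws_generators"
    using s by (auto simp: sws_generators_eq t_def)
  have "t \<otimes>\<^bsub>lamplighter\<^esub> s = \<one>\<^bsub>lamplighter\<^esub>"
    using s(2) by (auto simp: t_def s(1) lamplighter_def lamp_def fun_eq_iff)
  then have "inv\<^bsub>lamplighter\<^esub> s = t"
    using inv_equality t assms sws_generators_carrier by blast
  with t show ?thesis by simp
qed

lemma lamplighter_graph_sym: "pair_sym_digraph lamplighter_graph"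
  unfolding lamplighter_graph_def
  using group.cayley_graph_sym[OF group_lamplighter sws_generators_carrier] sws_generators_inv
  by blast

lemma finite_lamplighter_ball: "finite (gball lamplighter_graph r n)"
proof (rule finite_gball)
  show "pair_wf_digraph lamplighter_graph"
    using lamplighter_graph_sym by (simp add: pair_sym_digraph_def)
next
  fix x
  have bit: "a \<in> {0, 1}" for a :: bit by (cases a) auto
  have "sws_generators \<subseteq>
      (\<lambda>(a, b, \<epsilon>). (\<epsilon>, \<lambda>s. lamp a 0 s + lamp b \<epsilon> s)) ` ({0, 1} \<times> {0, 1} \<times> {1, -1})"
  proof
    fix s assume "s \<in> sws_generators"
    then obtain a b \<epsilon> where "s = (\<epsilon>, \<lambda>t. lamp a 0 t + lamp b \<epsilon> t)" "\<epsilon> \<in> {1, -1}"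
      by (auto simp: sws_generators_eq)
    then show "s \<in> (\<lambda>(a, b, \<epsilon>). (\<epsilon>, \<lambda>s. lamp a 0 s + lamp b \<epsilon> s)) ` ({0, 1} \<times> {0, 1} \<times> {1, -1})"
      using bit[of a] bit[of b] by (intro image_eqI[of _ _ "(a, b, \<epsilon>)"]) (simp_all only: split mem_Times_iff fst_conv snd_conv)
  qed
  then have "finite sws_generators" by (rule finite_subset) simp
  then have "finite ((\<lambda>s. x \<otimes>\<^bsub>lamplighter\<^esub> s) ` sws_generators)" by simp
  then show "finite {y. (x, y) \<in> parcs lamplighter_graph}"
    by (rule rev_finite_subset) (auto simp: lamplighter_graph_def)
qed

end

theory Submission
  imports Defs
begin

text \<open>
  A move from \<open>k\<close> to \<open>k \<plusminus> 1\<close> only touches the lamps at its two end points.  Hence the only way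
  into the region \<open>H\<close> of all elements whose walker is at some \<open>k \<ge> m\<close> and whose lamps below \<open>m\<close>
  are off is through its bottom layer, where the walker is exactly at \<open>m\<close>: once above \<open>m\<close>, the
  walker cannot alter the lamps below \<open>m\<close>.  So it suffices to protect the bottom layer in time.
  The layer is infinite, but an element of it with a lit lamp at \<open>m + j\<close> is expensive to reach:
  if \<open>m\<close> is large compared with the initial fire, the walker has to climb to \<open>m + j\<close> and come back to
  \<open>m\<close>, which costs \<open>2j\<close> moves (\<open>fire_reach\<close>).  At time \<open>n\<close> only the
  \<open>2 ^ (n div 2 + 1) \<le> 2 powr ((n + 2) / 2)\<close> elements with lamps in \<open>{m..m + n div 2}\<close> are
  threatened, and they can all be protected at once.

  It remains to see that \<open>H\<close> occupies a positive proportion of every large ball.  Climbing straight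
  from \<open>0\<close> to \<open>n\<close> reaches \<open>2 ^ (n - m)\<close> elements of \<open>H\<close>, while the ball of radius \<open>n\<close> has at most
  \<open>32 * 2 ^ n\<close> elements (\<open>card_ball_le\<close>): a walk visiting exactly the interval \<open>{-a..b}\<close>
  and ending at \<open>k\<close> has length at least \<open>2 * a + 2 * b - \<bar>k\<bar>\<close>, so every detour costs more moves
  than it gains in lamps, and the number of configurations is dominated by a straight walk.
\<close>

section \<open>Configurations and edges\<close>

definition configs :: "int set \<Rightarrow> (int \<Rightarrow> bit) set" where
  "configs A = {L. \<forall>s. L s \<noteq> 0 \<longrightarrow> s \<in> A}"

lemma bij_betw_configs: "bij_betw (\<lambda>L. {s. L s \<noteq> 0}) (configs A) (Pow A)"
proof (rule bij_betwI[where g = "\<lambda>B s. if s \<in> B then 1 else 0"])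
  show "(\<lambda>B s. if s \<in> B then 1 else 0) \<in> Pow A \<rightarrow> configs A"
    by (auto simp: configs_def split: if_splits)
qed (auto simp: configs_def fun_eq_iff)

lemma finite_configs: "finite A \<Longrightarrow> finite (configs A)"
  using bij_betw_finite[OF bij_betw_configs] by simp

lemma card_configs: "finite A \<Longrightarrow> card (configs A) = 2 ^ card A"
  using bij_betw_same_card[OF bij_betw_configs] by (simp add: card_Pow)

lemma lamplighter_carrier_iff:
  "(k, L) \<in> carrier lamplighter \<longleftrightarrow> finite {s. L s \<noteq> 0}"
  by (simp add: lamplighter_def)

lemma configs_in_carrier:
  assumes "finite A" "L \<in> configs A"
  shows "(k, L) \<in> carrier lamplighter"
  unfolding lamplighter_carrier_iff
  by (rule finite_subset[OF _ assms(1)]) (use assms(2) in \<open>auto simp: configs_def\<close>)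

lemma pverts_lamplighter_graph: "pverts lamplighter_graph = carrier lamplighter"
  by (simp add: lamplighter_graph_def)

lemma lamplighter_edge_iff:
  "((k, L), (k', L')) \<in> parcs lamplighter_graph \<longleftrightarrow>
     (k, L) \<in> carrier lamplighter \<and> \<bar>k' - k\<bar> = 1 \<and> (\<forall>s. s \<noteq> k \<and> s \<noteq> k' \<longrightarrow> L' s = L s)"
    (is "?edge \<longleftrightarrow> ?local")
proof
  assume ?edge
  then show ?local
    by (auto simp: lamplighter_graph_def sws_generators_eq lamplighter_def lamp_def)
next
  assume loc: ?local
  \<comment> \<open>The lamp at \<open>k\<close> is switched before the step and the lamp at \<open>k'\<close> after it.\<close>
  define t where "t = (k' - k, \<lambda>s. lamp (L k + L' k) 0 s + lamp (L k' + L' k') (k' - k) s)"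
  have "t \<in> sws_generators"
    using loc unfolding sws_generators_eq t_def by fastforce
  moreover have "(k', L') = (k, L) \<otimes>\<^bsub>lamplighter\<^esub> t"
    using loc by (auto simp: t_def lamplighter_def lamp_def fun_eq_iff simp flip: add.assoc)
  ultimately show ?edge
    using loc by (auto simp: lamplighter_graph_def simp del: split_paired_Ex)
qed

section \<open>Balls of the lamplighter graph\<close>

lemma (in pair_wf_digraph) awalk_invariant:
  assumes "awalk r p x" "P 0 r"
    and step: "\<And>n y z. P n y \<Longrightarrow> (y, z) \<in> parcs G \<Longrightarrow> P (Suc n) z"
  shows "P (length p) x"
  using assms(1)
proof (induction p arbitrary: x rule: rev_induct)
  case Nil
  then show ?case using assms(2) by (auto simp: awalk_Nil_iff)
next
  case (snoc e p)
  then have "awalk r p (fst e)" "e \<in> parcs G" "snd e = x"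
    by (auto simp: awalk_Cons_iff awalk_Nil_iff)
  then show ?case
    using step[of "length p" "fst e" x] snoc.IH by auto
qed

interpretation lamplighter: pair_wf_digraph lamplighter_graph
  using lamplighter_graph_sym by (simp add: pair_sym_digraph_def)

text \<open>
  Here \<open>- a\<close> and \<open>b\<close> are the extreme positions visited.  A walk that visits \<open>- a\<close> first and
  \<open>b\<close> last has length at least \<open>2 * a + b + (b - k)\<close>, in the other order at least
  \<open>2 * b + a + (k + a)\<close>; the smaller of the two is \<open>2 * a + 2 * b - \<bar>k\<bar>\<close>.  A move increases this
  quantity by at most one, also when it enlarges the visited interval, since the walker then
  stands at the new end.
\<close>

lemma walk_shape:
  assumes "lamplighter.awalk \<one>\<^bsub>lamplighter\<^esub> p (k, L)"
  shows "\<exists>a b. 0 \<le> a \<and> 0 \<le> b \<and> - a \<le> k \<and> k \<le> b \<and> L \<in> configs {- a..b} \<and>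
           2 * a + 2 * b - \<bar>k\<bar> \<le> int (length p)"
proof -
  define P where "P = (\<lambda>n::nat. \<lambda>(k, L). \<exists>a b. 0 \<le> a \<and> 0 \<le> b \<and> - a \<le> k \<and> k \<le> b \<and>
    L \<in> configs {- a..b} \<and> 2 * a + 2 * b - \<bar>k\<bar> \<le> int n)"
  have "P (length p) (k, L)"
  proof (rule lamplighter.awalk_invariant[OF assms])
    show "P 0 \<one>\<^bsub>lamplighter\<^esub>"
      by (auto simp: P_def lamplighter_def configs_def intro!: exI[of _ 0])
  next
    fix n y z
    assume P: "P n y" and yz: "(y, z) \<in> parcs lamplighter_graph"
    obtain k L k' L' where eqs: "y = (k, L)" "z = (k', L')" by fastforce
    from P obtain a b where ab: "0 \<le> a" "0 \<le> b" "- a \<le> k" "k \<le> b" "L \<in> configs {- a..b}"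
      "2 * a + 2 * b - \<bar>k\<bar> \<le> int n"
      by (auto simp: P_def eqs)
    from yz have e: "\<bar>k' - k\<bar> = 1" "\<And>s. s \<noteq> k \<Longrightarrow> s \<noteq> k' \<Longrightarrow> L' s = L s"
      by (auto simp: eqs lamplighter_edge_iff)
    have "s \<in> {- max a (- k')..max b k'}" if "L' s \<noteq> 0" for s
    proof (cases "s = k \<or> s = k'")
      case True
      then show ?thesis using ab by auto
    next
      case False
      then have "s \<in> {- a..b}" using e(2) that ab(5) by (auto simp: configs_def)
      then show ?thesis by auto
    qed
    then have "L' \<in> configs {- max a (- k')..max b k'}"
      by (auto simp: configs_def)
    moreover have "2 * max a (- k') + 2 * max b k' - \<bar>k'\<bar> \<le> int (Suc n)"
      using ab e(1) by linarith
    ultimately show "P (Suc n) z"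
      unfolding P_def eqs prod.case using ab
      by (intro exI[of _ "max a (- k')"] exI[of _ "max b k'"]) auto
  qed
  then show ?thesis by (simp add: P_def)
qed

text \<open>
  For \<open>k \<ge> 0\<close> the shape \<open>(a, b, k)\<close> is recorded by the three amounts of waste \<open>a\<close>, \<open>j = b - k\<close>
  and \<open>c = n - (2 * a + 2 * b - k)\<close>: each unit of waste halves the number \<open>2 ^ (a + b + 1)\<close> of
  configurations, so the shapes are summed by a product of three geometric series.  The
  case \<open>k \<le> 0\<close> is the mirror image.
\<close>

lemma card_ball_le:
  "real (card (gball lamplighter_graph \<one>\<^bsub>lamplighter\<^esub> n)) \<le> 32 * 2 ^ n"
proof -
  let ?B = "gball lamplighter_graph \<one>\<^bsub>lamplighter\<^esub> n"
  define I where "I = {..n} \<times> {..n} \<times> {..n}"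
  define b :: "nat \<times> nat \<times> nat \<Rightarrow> int" where
    "b = (\<lambda>(a, j, c). int n - 2 * int a - int j - int c)"
  \<comment> \<open>The index lists the waste, and \<open>b\<close> recovers the end of the interval from it.  The second
      box is the mirror image of the first.\<close>
  define X where "X = (\<lambda>(a, j, c). if 2 * a + j + c \<le> n then
      {b (a, j, c) - int j} \<times> configs {- int a..b (a, j, c)} \<union>
      {int j - b (a, j, c)} \<times> configs {- b (a, j, c)..int a} else {})"
  define g :: "nat \<Rightarrow> real" where "g = (\<lambda>i. (1 / 2) ^ i)"
  have finX: "finite (X i)" for i
    by (cases i) (auto simp: X_def intro!: finite_configs)
  have sub: "?B \<subseteq> (\<Union>i\<in>I. X i)"
  proof
    fix x assume "x \<in> ?B"
    then obtain k L p where x: "x = (k, L)" and "lamplighter.awalk \<one>\<^bsub>lamplighter\<^esub> p (k, L)"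
      and p: "length p \<le> n"
      by (cases x) (auto simp: gball_def)
    then obtain a d where ad: "0 \<le> a" "0 \<le> d" "- a \<le> k" "k \<le> d" "L \<in> configs {- a..d}"
      "2 * a + 2 * d - \<bar>k\<bar> \<le> int n"
      using walk_shape by force
    show "x \<in> (\<Union>i\<in>I. X i)"
    proof (cases "k \<ge> 0")
      case True
      let ?i = "(nat a, nat (d - k), nat (int n - (2 * a + 2 * d - k)))"
      have "b ?i = d" using ad True by (simp add: b_def)
      moreover have "nat a + nat a + nat (d - k) + nat (int n - (2 * a + 2 * d - k)) \<le> n"
        using ad True by linarith
      ultimately have "?i \<in> I" "x \<in> X ?i"
        using ad True by (auto simp: I_def X_def x)
      then show ?thesis by blast
    next
      case False
      let ?i = "(nat d, nat (a + k), nat (int n - (2 * a + 2 * d + k)))"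
      have "b ?i = a" using ad False by (simp add: b_def)
      moreover have "nat d + nat d + nat (a + k) + nat (int n - (2 * a + 2 * d + k)) \<le> n"
        using ad False by linarith
      ultimately have "?i \<in> I" "x \<in> X ?i"
        using ad False by (auto simp: I_def X_def x)
      then show ?thesis by blast
    qed
  qed
  have cardX: "real (card (X (a, j, c))) \<le> 4 * 2 ^ n * (g a * (g j * g c))" for a j c
  proof (cases "2 * a + j + c \<le> n")
    case True
    define m where "m = n - 2 * a - j - c"
    have n: "n = 2 * a + j + c + m" using True by (simp add: m_def)
    have bm: "b (a, j, c) = int m" by (simp add: b_def n)
    have "card (X (a, j, c)) \<le>
        card ({int m - int j} \<times> configs {- int a..int m}) +
        card ({int j - int m} \<times> configs {- int m..int a})"
      using True by (simp add: X_def bm card_Un_le)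
    also have "\<dots> = 2 * 2 ^ (a + m + 1)"
      by (simp add: card_cartesian_product card_configs nat_add_distrib add.commute)
    finally have "real (card (X (a, j, c))) \<le> real (2 * 2 ^ (a + m + 1))"
      by (rule of_nat_mono)
    also have "\<dots> = 4 * 2 ^ n * (g a * (g j * g c))"
      by (simp add: n g_def power_add power_mult power_one_over field_simps power2_eq_square)
    finally show ?thesis .
  next
    case False
    then show ?thesis by (simp add: X_def g_def)
  qed
  have geo: "(\<Sum>i\<le>n. g i) \<le> 2"
    using geometric_sum[of "1 / 2 :: real" "Suc n"] by (simp add: g_def lessThan_Suc_atMost)
  have g0: "0 \<le> (\<Sum>i\<le>n. g i)" by (simp add: g_def sum_nonneg)
  have "card ?B \<le> card (\<Union>i\<in>I. X i)"
    using sub by (intro card_mono) (auto simp: I_def finX)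
  also have "\<dots> \<le> (\<Sum>i\<in>I. card (X i))"
    by (rule card_UN_le) (simp add: I_def)
  finally have "real (card ?B) \<le> (\<Sum>i\<in>I. real (card (X i)))"
    by (simp flip: of_nat_sum)
  also have "\<dots> \<le> (\<Sum>(a, j, c)\<in>I. 4 * 2 ^ n * (g a * (g j * g c)))"
    by (intro sum_mono) (use cardX in auto)
  also have "\<dots> = 4 * 2 ^ n * ((\<Sum>i\<le>n. g i) * ((\<Sum>i\<le>n. g i) * (\<Sum>i\<le>n. g i)))"
    by (simp add: I_def sum.cartesian_product[symmetric] flip: sum_distrib_left sum_distrib_right)
  also have "\<dots> \<le> 4 * 2 ^ n * (2 * (2 * 2))"
    using geo g0 by (intro mult_left_mono mult_mono) auto
  finally show ?thesis by simp
qed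

text \<open>
  The interval is half-open so that the climb can be built step by step from the empty walk,
  which switches no lamp.
\<close>

lemma climb_in_ball:
  "L \<in> configs {0..<int n} \<Longrightarrow> (int n, L) \<in> gball lamplighter_graph \<one>\<^bsub>lamplighter\<^esub> n"
proof -
  assume L: "L \<in> configs {0..<int n}"
  have "\<exists>p. lamplighter.awalk \<one>\<^bsub>lamplighter\<^esub> p (int n, L) \<and> length p = n"
    using L
  proof (induction n arbitrary: L)
    case 0
    then have "(int 0, L) = \<one>\<^bsub>lamplighter\<^esub>"
      by (auto simp: configs_def lamplighter_def fun_eq_iff)
    then show ?case
      using group.is_monoid[OF group_lamplighter, THEN monoid.one_closed]
      by (auto simp: lamplighter.awalk_Nil_iff pverts_lamplighter_graph)
  next
    case (Suc n)
    \<comment> \<open>The lamp at \<open>n\<close> is set when the walker leaves \<open>n\<close>.\<close>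
    have L0: "L(int n := 0) \<in> configs {0..<int n}"
      using Suc.prems by (force simp: configs_def)
    then obtain p where p: "lamplighter.awalk \<one>\<^bsub>lamplighter\<^esub> p (int n, L(int n := 0))"
      "length p = n"
      using Suc.IH by blast
    have "((int n, L(int n := 0)), (int (Suc n), L)) \<in> parcs lamplighter_graph"
      unfolding lamplighter_edge_iff using configs_in_carrier[OF _ L0] by auto
    then have "lamplighter.awalk (int n, L(int n := 0))
        [((int n, L(int n := 0)), (int (Suc n), L))] (int (Suc n), L)"
      by (simp add: lamplighter.awalk_Cons_iff lamplighter.awalk_Nil_iff
          pverts_lamplighter_graph configs_in_carrier[OF _ Suc.prems])
    from lamplighter.awalk_appendI[OF p(1) this] show ?case
      using p(2) by (intro exI conjI) (assumption, simp)
  qed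
  then show ?thesis
    using configs_in_carrier[OF _ L] by (auto simp: gball_def pverts_lamplighter_graph)
qed

section \<open>Containing a fire\<close>

text \<open>
  Reduces containment to single crossings: only those edges matter that lead from burning vertices
  outside \<open>H\<close> into \<open>H\<close>, since as long as \<open>H\<close> is intact there is no fire inside to spread.
\<close>

lemma fire_avoids:
  assumes "F\<^sub>0 \<inter> H = {}"
    and "\<And>n x y. y \<in> fire G F\<^sub>0 W n \<Longrightarrow> y \<notin> H \<Longrightarrow> x \<in> H \<Longrightarrow> (y, x) \<in> parcs G \<Longrightarrow> x \<in> W (Suc n)"
  shows "fire G F\<^sub>0 W n \<inter> H = {}"
proof (induction n)
  case (Suc n)
  have False if x: "x \<in> H" "x \<notin> (\<Union>i\<in>{1..Suc n}. W i)" "y \<in> fire G F\<^sub>0 W n" "(y, x) \<in> parcs G"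
    for x y
    using assms(2)[of y n x] x Suc.IH by auto
  then show ?case using Suc.IH by auto
qed (use assms(1) in simp)

text \<open>
  An over-approximation, closed under moves, of what a walker starting at \<open>m\<close> with all lamps above
  \<open>m\<close> off can attain in \<open>n\<close> moves: to light a lamp at \<open>s > m\<close> and to stand at \<open>k < s\<close>
  afterwards, it has to go up to \<open>s\<close> and back down to \<open>k\<close>.
\<close>

definition reach :: "int \<Rightarrow> nat \<Rightarrow> (int \<times> (int \<Rightarrow> bit)) set" where
  "reach m n = {(k, L). k - m \<le> int n \<and> (\<forall>s. L s \<noteq> 0 \<longrightarrow> (s - m) + (s - k) \<le> int n)}"

lemma reach_step:
  assumes "x \<in> reach m n" "(x, y) \<in> parcs lamplighter_graph"
  shows "y \<in> reach m (Suc n)"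
proof -
  obtain k L k' L' where xy: "x = (k, L)" "y = (k', L')" by fastforce
  have x: "k - m \<le> int n" "\<And>s. L s \<noteq> 0 \<Longrightarrow> (s - m) + (s - k) \<le> int n"
    using assms(1) by (auto simp: xy reach_def)
  have step: "\<bar>k' - k\<bar> = 1" and eq: "\<And>s. s \<noteq> k \<Longrightarrow> s \<noteq> k' \<Longrightarrow> L' s = L s"
    using assms(2) by (auto simp: xy lamplighter_edge_iff)
  have "(s - m) + (s - k') \<le> int (Suc n)" if "L' s \<noteq> 0" for s
  proof (cases "s = k \<or> s = k'")
    case True
    then show ?thesis using x(1) step by linarith
  next
    case False
    then have "L s \<noteq> 0" using eq that by metis
    then show ?thesis using x(2)[of s] step by linarith
  qed
  then show ?thesis using x(1) step by (auto simp: xy reach_def)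
qed

text \<open>Protection only slows the fire down, so the bound on unhindered walks applies for every \<open>W\<close>.\<close>

lemma fire_reach:
  assumes "F\<^sub>0 \<subseteq> reach m 0"
  shows "fire lamplighter_graph F\<^sub>0 W n \<subseteq> reach m n"
proof (induction n)
  case (Suc n)
  have "reach m n \<subseteq> reach m (Suc n)" by (force simp: reach_def)
  then show ?case using Suc.IH reach_step by auto
qed (use assms in simp)

definition region :: "int \<Rightarrow> (int \<times> (int \<Rightarrow> bit)) set" where
  "region m = {(k, L) \<in> carrier lamplighter. m \<le> k \<and> L \<in> configs {m..}}"

text \<open>
  A walker strictly above \<open>m\<close> came from a position at or above \<open>m\<close>, so its last move left the lamps
  below \<open>m\<close> alone and started in the region already.
\<close>

lemma region_entry:
  assumes "((k', L'), (k, L)) \<in> parcs lamplighter_graph" "(k', L') \<notin> region m" "(k, L) \<in> region m"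
  shows "k = m"
proof (rule ccontr)
  assume "k \<noteq> m"
  then have k: "m < k" using assms(3) by (simp add: region_def)
  have e: "(k', L') \<in> carrier lamplighter" "\<bar>k - k'\<bar> = 1"
    "\<And>s. s \<noteq> k' \<Longrightarrow> s \<noteq> k \<Longrightarrow> L s = L' s"
    using assms(1) by (auto simp: lamplighter_edge_iff)
  then have k': "m \<le> k'" using k by linarith
  have "s \<in> {m..}" if "L' s \<noteq> 0" for s
    using e(3)[of s] that k k' assms(3) by (cases "s = k \<or> s = k'") (auto simp: region_def configs_def)
  then have "(k', L') \<in> region m"
    using e(1) k' by (auto simp: region_def configs_def)
  with assms(2) show False by simp
qed

text \<open>
  The first bound keeps the initial fire out of \<open>region m\<close>; both together place it inside
  \<open>reach m 0\<close>.
\<close>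

lemma initial_fire_below:
  assumes "finite F\<^sub>0" "F\<^sub>0 \<subseteq> carrier lamplighter"
  obtains m :: nat where
    "\<And>k L. (k, L) \<in> F\<^sub>0 \<Longrightarrow> k < int m \<and> (\<forall>s. L s \<noteq> 0 \<longrightarrow> (s - int m) + (s - k) \<le> 0)"
proof -
  define T where "T = (\<Union>(k, L)\<in>F\<^sub>0. insert k ((\<lambda>s. 2 * s - k) ` {s. L s \<noteq> 0}))"
  have "finite (insert k ((\<lambda>s. 2 * s - k) ` {s. L s \<noteq> 0}))" if "(k, L) \<in> F\<^sub>0" for k L
    using that assms(2) lamplighter_carrier_iff by blast
  then have "finite T"
    unfolding T_def by (intro finite_UN_I assms(1)) auto
  then obtain m where m: "\<And>t. t \<in> nat ` T \<Longrightarrow> t < m"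
    using finite_nat_set_iff_bounded[of "nat ` T"] by auto
  show ?thesis
  proof (rule that[of m], intro conjI allI impI)
    fix k L assume kL: "(k, L) \<in> F\<^sub>0"
    then have "k \<in> T" by (auto simp: T_def)
    then show "k < int m" using m[of "nat k"] by auto
    fix s assume "L s \<noteq> 0"
    then have "2 * s - k \<in> T" unfolding T_def by (intro UN_I[OF kL]) auto
    then show "(s - int m) + (s - k) \<le> 0" using m[of "nat (2 * s - k)"] by auto
  qed
qed

section \<open>Strong retainment\<close>

theorem theorem5p1:
  shows "strong_retaining lamplighter_graph \<one>\<^bsub>lamplighter\<^esub> (\<lambda>n. 2 powr ((real n + 2) / 2))"
  unfolding strong_retaining_def
proof (intro allI impI)
  let ?G = lamplighter_graph
  fix F\<^sub>0 :: "(int \<times> (int \<Rightarrow> bit)) set"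
  assume "finite F\<^sub>0 \<and> F\<^sub>0 \<subseteq> pverts ?G"
  then obtain m :: nat where m:
    "\<And>k L. (k, L) \<in> F\<^sub>0 \<Longrightarrow> k < int m \<and> (\<forall>s. L s \<noteq> 0 \<longrightarrow> (s - int m) + (s - k) \<le> 0)"
    using initial_fire_below pverts_lamplighter_graph by metis
  let ?H = "region (int m)"
  define W where "W = (\<lambda>n::nat. {int m} \<times> configs {int m..int m + int (n div 2)})"
  have W_H: "W n \<subseteq> ?H" for n
    using configs_in_carrier[of "{int m..int m + int (n div 2)}"]
    by (fastforce simp: W_def region_def configs_def)
  have W_card: "card (W n) = 2 ^ (n div 2 + 1)" for n
    by (simp add: W_def card_cartesian_product card_configs nat_add_distrib)
  have avoid: "fire ?G F\<^sub>0 W n \<inter> ?H = {}" for n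
  proof (rule fire_avoids)
    show "F\<^sub>0 \<inter> ?H = {}" using m by (force simp: region_def)
  next
    fix n x y
    assume y: "y \<in> fire ?G F\<^sub>0 W n" "y \<notin> ?H" and x: "x \<in> ?H" and e: "(y, x) \<in> parcs ?G"
    obtain k L where kL: "x = (k, L)" by fastforce
    have k: "k = int m" using region_entry y(2) x e unfolding kL by (cases y) blast
    have "y \<in> reach (int m) n"
      using fire_reach[of F\<^sub>0 "int m" W n] m y(1) by (force simp: reach_def)
    then have "x \<in> reach (int m) (Suc n)"
      using e by (rule reach_step)
    then have "s \<le> int m + int (Suc n div 2)" if "L s \<noteq> 0" for s
      using that k by (fastforce simp: kL reach_def)
    then show "x \<in> W (Suc n)"
      using x by (auto simp: W_def kL k region_def configs_def)
  qed
  show "\<exists>c::real. c > 0 \<and> (\<exists>W. allowed_strategy ?G (\<lambda>n. 2 powr ((real n + 2) / 2)) F\<^sub>0 W \<and>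
      (\<forall>\<^sub>F n in sequentially. real (card (never_on_fire ?G F\<^sub>0 W \<inter>
         gball ?G \<one>\<^bsub>lamplighter\<^esub> n)) \<ge> c * real (card (gball ?G \<one>\<^bsub>lamplighter\<^esub> n))))"
  proof (intro exI conjI)
    show "1 / (32 * 2 ^ m) > (0 :: real)" by simp
  next
    show "allowed_strategy ?G (\<lambda>n. 2 powr ((real n + 2) / 2)) F\<^sub>0 W"
      unfolding allowed_strategy_def
    proof (intro allI impI conjI)
      fix n :: nat
      show "W n \<subseteq> pverts ?G"
        using W_H by (auto simp: region_def pverts_lamplighter_graph)
      show "finite (W n)" by (simp add: W_def finite_configs)
      have "real (card (W n)) = 2 powr real (n div 2 + 1)"
        by (subst powr_realpow) (simp_all add: W_card)
      also have "\<dots> \<le> 2 powr ((real n + 2) / 2)"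
      proof (rule powr_mono)
        have "2 * (n div 2) \<le> n" by simp
        then have "real (2 * (n div 2)) \<le> real n" by (rule of_nat_mono)
        then show "real (n div 2 + 1) \<le> (real n + 2) / 2" by simp
      qed simp
      finally show "real (card (W n)) \<le> 2 powr ((real n + 2) / 2)" .
      show "W n \<inter> fire ?G F\<^sub>0 W (n - 1) = {}"
        using W_H avoid by blast
    qed
  next
    show "\<forall>\<^sub>F n in sequentially. real (card (never_on_fire ?G F\<^sub>0 W \<inter>
         gball ?G \<one>\<^bsub>lamplighter\<^esub> n)) \<ge> 1 / (32 * 2 ^ m) * real (card (gball ?G \<one>\<^bsub>lamplighter\<^esub> n))"
    proof (rule eventually_sequentiallyI[of m])
      fix n assume mn: "m \<le> n"
      let ?B = "gball ?G \<one>\<^bsub>lamplighter\<^esub> n"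
      let ?C = "{int n} \<times> configs {int m..<int n}"
      have "?C \<subseteq> never_on_fire ?G F\<^sub>0 W \<inter> ?B"
      proof
        fix x assume "x \<in> ?C"
        then obtain L where L: "x = (int n, L)" "L \<in> configs {int m..<int n}" by blast
        then have "x \<in> ?H"
          using mn configs_in_carrier[OF _ L(2)] by (auto simp: region_def configs_def)
        moreover have "x \<in> ?B"
          unfolding L(1) by (rule climb_in_ball) (use L(2) in \<open>force simp: configs_def\<close>)
        ultimately show "x \<in> never_on_fire ?G F\<^sub>0 W \<inter> ?B"
          using avoid by (auto simp: never_on_fire_def gball_def)
      qed
      then have "card ?C \<le> card (never_on_fire ?G F\<^sub>0 W \<inter> ?B)"
        by (intro card_mono) (simp_all add: finite_lamplighter_ball)
      moreover have "card ?C = 2 ^ (n - m)"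
        using mn by (simp add: card_cartesian_product card_configs flip: of_nat_diff)
      ultimately have lower: "(2 :: real) ^ (n - m) \<le> real (card (never_on_fire ?G F\<^sub>0 W \<inter> ?B))"
        by (metis of_nat_le_iff of_nat_numeral of_nat_power)
      have "real (card ?B) \<le> 32 * 2 ^ n" by (rule card_ball_le)
      also have "(2 :: real) ^ n = 2 ^ m * 2 ^ (n - m)"
        using mn by (simp flip: power_add)
      finally have "real (card ?B) \<le> 32 * 2 ^ m * 2 ^ (n - m)" by simp
      also have "\<dots> \<le> 32 * 2 ^ m * real (card (never_on_fire ?G F\<^sub>0 W \<inter> ?B))"
        by (intro mult_left_mono lower) simp
      finally show "1 / (32 * 2 ^ m) * real (card ?B)
          \<le> real (card (never_on_fire ?G F\<^sub>0 W \<inter> ?B))"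
        by (simp add: field_simps)
    qed
  qed
qed

end
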